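(* (i) Let $m\ge 2$ and let $LP_{2,m}$ be a long brush graph in which $v_1$ is adjacent to none of $v_2,\dots,v_m$ (i.e. $\langle v_1,\dots,v_m\rangle=K_1(v_1)\cup\langle v_2,\dots,v_m\rangle$). Then $LP_{2,m}$ is not $2$-distance magic. (ii) Let $m\ge 2$, $n\ge 3$ and let $LP_{n,m}$ be a long brush graph in which $v_1$ and $v_2$ are each adjacent to none of the other vertices $v_i$ (i.e. $\langle v_1,\dots,v_m\rangle=K_1(v_1)\cup K_1(v_2)\cup\langle v_3,\dots,v_m\rangle$). Then $LP_{n,m}$ is not $2$-distance magic.
   Context: All graphs are finite, simple and undirected; $d(u,v)$ is graph distance. For $u\in V(G)$ and $k\in\mathbb{N}$, $\partial N_k(u)=\{v\in V(G): d(u,v)=k\}$. For a graph $G$ of order $p\ge3$, a $k$-distance magic labeling is a bijection $f:V(G)\to\{1,\dots,p\}$ such that $\sum_{w\in\partial N_k(u)} f(w)$ is a constant independent of $u\in V(G)$; $G$ is $k$-distance magic if it has such a labeling. A long brush $LP_{n,m}$ ($m,n\in\mathbb{N}$, $m+n\ge3$) has vertex set $\{u_1,\dots,u_n,v_1,\dots,v_m\}$, with edges $u_iu_{i+1}$ ($1\le i<n$), $u_1v_i$ ($1\le i\le m$), and an arbitrary set of edges among $v_1,\dots,v_m$; $\langle v_1,\dots,v_m\rangle$ denotes the induced subgraph on $\{v_1,\dots,v_m\}$. *)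

theory Defs
  imports "Graph_Theory.Pair_Digraph" "Graph_Theory.Shortest_Path"
begin

text \<open>
  Finite simple undirected graphs are modelled by the locale \<open>pair_graph\<close>: finite, loop-free
  digraphs without parallel arcs whose arc relation \<open>parcs G\<close> is symmetric, so that
  \<open>(x, y) \<in> parcs G\<close> says that \<open>x\<close> and \<open>y\<close> are adjacent.
\<close>

text \<open>
  With unit weights the cost of a walk is its length, so this is the least length of a walk
  between the two vertices, and \<open>\<infinity>\<close> if there is none.
\<close>

definition graph_dist :: "'a pair_pre_digraph \<Rightarrow> 'a \<Rightarrow> 'a \<Rightarrow> ereal" where
  "graph_dist G x y = wf_digraph.\<mu> (with_proj G) (\<lambda>_. 1) x y"

definition dist_sphere :: "'a pair_pre_digraph \<Rightarrow> nat \<Rightarrow> 'a \<Rightarrow> 'a set" where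
  "dist_sphere G k x = {y \<in> pverts G. graph_dist G x y = ereal (real k)}"

definition distance_magic_labeling :: "'a pair_pre_digraph \<Rightarrow> nat \<Rightarrow> ('a \<Rightarrow> nat) \<Rightarrow> bool" where
  "distance_magic_labeling G k f \<longleftrightarrow>
     bij_betw f (pverts G) {1..card (pverts G)} \<and>
     (\<exists>c. \<forall>x\<in>pverts G. (\<Sum>y\<in>dist_sphere G k x. f y) = c)"

definition distance_magic :: "'a pair_pre_digraph \<Rightarrow> nat \<Rightarrow> bool" where
  "distance_magic G k \<longleftrightarrow> (\<exists>f. distance_magic_labeling G k f)"

text \<open>
  \<open>G\<close> is a long brush with handle \<open>u 1, \<dots>, u n\<close> and bristles \<open>v 1, \<dots>, v m\<close>. The values of
  \<open>u\<close> and \<open>v\<close> outside \<open>{1..n}\<close> and \<open>{1..m}\<close> are irrelevant. The adjacency between the \<open>v i\<close> is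
  deliberately left unconstrained.
\<close>

locale long_brush = pair_graph G for G :: "'a pair_pre_digraph" +
  fixes n m :: nat and u v :: "nat \<Rightarrow> 'a"
  assumes n_pos: "1 \<le> n" and m_pos: "1 \<le> m" and order_ge_3: "3 \<le> m + n"
    and inj_u: "inj_on u {1..n}"
    and inj_v: "inj_on v {1..m}"
    and disjoint_uv: "u ` {1..n} \<inter> v ` {1..m} = {}"
    and verts_brush: "pverts G = u ` {1..n} \<union> v ` {1..m}"
    and adj_uu: "\<And>i j. i \<in> {1..n} \<Longrightarrow> j \<in> {1..n} \<Longrightarrow>
      (u i, u j) \<in> parcs G \<longleftrightarrow> j = i + 1 \<or> i = j + 1"
    and adj_uv: "\<And>i j. i \<in> {1..n} \<Longrightarrow> j \<in> {1..m} \<Longrightarrow> (u i, v j) \<in> parcs G \<longleftrightarrow> i = 1"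

end

theory Submission
  imports Defs
begin

text \<open>
  The labels of the second sphere around a vertex must add up to the same constant everywhere.
  With handle length 2 the vertex \<open>u 1\<close> is adjacent to everything, so this constant would be 0,
  although \<open>u 2\<close> has \<open>v 1\<close> at distance 2. With a longer handle, the second sphere around an
  isolated bristle consists of \<open>u 2\<close> and all other bristles; comparing the two isolated bristles
  \<open>v 1\<close> and \<open>v 2\<close> forces their labels to coincide.
\<close>

lemma (in pair_wf_digraph) awalk_cost_unit: "awalk_cost (\<lambda>_. 1) p = real (length p)"
  by (induction p) auto

text \<open>Walk lengths are naturals, so a finite infimum of them is attained. This replaces the
  \<open>ereal\<close>-valued distance by a shortest walk.\<close>

lemma (in pair_wf_digraph) graph_dist_eq_iff:
  "graph_dist G x y = ereal (real k) \<longleftrightarrow>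
     (\<exists>p. awalk x p y \<and> length p = k) \<and> (\<forall>p. awalk x p y \<longrightarrow> k \<le> length p)"
proof
  assume d: "graph_dist G x y = ereal (real k)"
  have lower: "k \<le> length p" if "awalk x p y" for p
    using min_cost_le_walk_cost[OF that, of "\<lambda>_. 1"] d
    by (simp add: graph_dist_def awalk_cost_unit)
  \<comment> \<open>Relaxing \<open>k\<close> to \<open>Suc k\<close> gives the strict bound needed
    to extract a walk from the infimum; integrality then closes the gap.\<close>
  have "\<mu> (\<lambda>_. 1) x y < ereal (real (Suc k))"
    using d by (simp add: graph_dist_def)
  then obtain p where "awalk x p y" "length p < Suc k"
    by (auto simp: \<mu>_def INF_less_iff awalk_cost_unit)
  with lower show "(\<exists>p. awalk x p y \<and> length p = k) \<and> (\<forall>p. awalk x p y \<longrightarrow> k \<le> length p)"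
    by (metis le_antisym less_Suc_eq_le)
next
  assume "(\<exists>p. awalk x p y \<and> length p = k) \<and> (\<forall>p. awalk x p y \<longrightarrow> k \<le> length p)"
  then show "graph_dist G x y = ereal (real k)"
    unfolding graph_dist_def \<mu>_def
    by (intro antisym INF_greatest) (auto simp: awalk_cost_unit intro: INF_lower2)
qed

text \<open>Bridge from distance to adjacency. That \<open>y\<close> is a vertex stays implicit on
  the right, since it is the head of an arc.\<close>

lemma (in pair_wf_digraph) mem_dist_sphere_2_iff:
  "y \<in> dist_sphere G 2 x \<longleftrightarrow>
     x \<noteq> y \<and> (x, y) \<notin> parcs G \<and> (\<exists>z. (x, z) \<in> parcs G \<and> (z, y) \<in> parcs G)"
    (is "_ \<longleftrightarrow> ?R")
proof
  assume "y \<in> dist_sphere G 2 x"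
  then have "graph_dist G x y = ereal (real 2)" and y: "y \<in> pverts G"
    by (simp_all add: dist_sphere_def)
  then obtain p where p: "awalk x p y" "length p = 2"
    and min: "\<And>q. awalk x q y \<Longrightarrow> 2 \<le> length q"
    unfolding graph_dist_eq_iff by blast
  then obtain e e' where "p = [e, e']"
    by (auto simp: numeral_2_eq_2 length_Suc_conv)
  with p have "\<exists>z. (x, z) \<in> parcs G \<and> (z, y) \<in> parcs G"
    by (cases e; cases e') (auto simp: awalk_simps)
  \<comment> \<open>Otherwise the empty walk, or below the single arc, would be a walk of length
    less than 2.\<close>
  moreover have "x \<noteq> y" using min[of "[]"] y by (auto simp: awalk_simps)
  moreover have "(x, y) \<notin> parcs G" using min[of "[(x, y)]"] y by (auto simp: awalk_simps)
  ultimately show ?R by blast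
next
  assume R: ?R
  then obtain z where z: "(x, z) \<in> parcs G" "(z, y) \<in> parcs G" by blast
  then have y: "y \<in> pverts G" using arc_snd_in_verts by fastforce
  have "awalk x [(x, z), (z, y)] y" using z y by (simp add: awalk_simps)
  \<comment> \<open>A shorter walk is empty or a single arc, making \<open>x\<close> and
    \<open>y\<close> equal or adjacent, which \<open>R\<close> excludes.\<close>
  moreover have "2 \<le> length p" if "awalk x p y" for p
  proof (cases p)
    case Nil
    with that R show ?thesis by (simp add: awalk_simps)
  next
    case (Cons e es)
    with that R show ?thesis by (cases e; cases es) (auto simp: awalk_simps)
  qed
  ultimately have "graph_dist G x y = ereal (real 2)"
    unfolding graph_dist_eq_iff by (auto intro!: exI[of _ "[(x, z), (z, y)]"])
  with y show "y \<in> dist_sphere G 2 x" by (simp add: dist_sphere_def)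
qed

lemma distance_magic_labeling_inj:
  "distance_magic_labeling G k f \<Longrightarrow> inj_on f (pverts G)"
  by (auto simp: distance_magic_labeling_def dest: bij_betw_imp_inj_on)

lemma distance_magic_labeling_pos:
  "distance_magic_labeling G k f \<Longrightarrow> x \<in> pverts G \<Longrightarrow> 0 < f x"
  unfolding distance_magic_labeling_def bij_betw_def by fastforce

lemma distance_magic_labeling_sum_eq:
  "distance_magic_labeling G k f \<Longrightarrow> x \<in> pverts G \<Longrightarrow> y \<in> pverts G \<Longrightarrow>
     sum f (dist_sphere G k x) = sum f (dist_sphere G k y)"
  by (auto simp: distance_magic_labeling_def)

context long_brush
begin

lemma u_in_verts: "i \<in> {1..n} \<Longrightarrow> u i \<in> pverts G"
  and v_in_verts: "i \<in> {1..m} \<Longrightarrow> v i \<in> pverts G"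
  by (auto simp: verts_brush)

lemma u_neq_v: "i \<in> {1..n} \<Longrightarrow> j \<in> {1..m} \<Longrightarrow> u i \<noteq> v j"
  using disjoint_uv by blast

lemma adj_sym: "(x, y) \<in> parcs G \<Longrightarrow> (y, x) \<in> parcs G"
  using pair_sym_arcs by (auto simp: symmetric_def sym_def)

lemma adj_vu: "i \<in> {1..n} \<Longrightarrow> j \<in> {1..m} \<Longrightarrow> (v j, u i) \<in> parcs G \<longleftrightarrow> i = 1"
  using adj_uv adj_sym by blast

lemma finite_dist_sphere: "finite (dist_sphere G k x)"
  using pair_finite_verts by (simp add: dist_sphere_def)

lemma short_brush_not_distance_magic:
  assumes n: "n = 2"
  shows "\<not> distance_magic G 2"
proof
  assume "distance_magic G 2"
  then obtain f where f: "distance_magic_labeling G 2 f" by (auto simp: distance_magic_def)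
  have "dist_sphere G 2 (u 1) = {}"
  proof (rule equals0I)
    fix y assume y: "y \<in> dist_sphere G 2 (u 1)"
    then have "y \<noteq> u 1" "(u 1, y) \<notin> parcs G" by (auto simp: mem_dist_sphere_2_iff)
    moreover have "(\<exists>i\<in>{1..n}. y = u i) \<or> (\<exists>j\<in>{1..m}. y = v j)"
      using y by (auto simp: dist_sphere_def verts_brush)
    moreover have "y = u 1 \<or> (u 1, y) \<in> parcs G" if "i \<in> {1..n}" "y = u i" for i
      using that adj_uu[of 1 i] n by (cases "i = 1") auto
    moreover have "(u 1, y) \<in> parcs G" if "j \<in> {1..m}" "y = v j" for j
      using that adj_uv[of 1 j] n by simp
    ultimately show False by blast
  qed
  then have "sum f (dist_sphere G 2 (u 2)) = 0"
    using distance_magic_labeling_sum_eq[OF f, of "u 1" "u 2"] u_in_verts n by simp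
  \<comment> \<open>The connecting vertex is \<open>u 1\<close>; bristles attach to the handle only
    there, so \<open>u 2\<close> and \<open>v 1\<close> are not adjacent.\<close>
  moreover have "v 1 \<in> dist_sphere G 2 (u 2)"
    unfolding mem_dist_sphere_2_iff
    using adj_uu[of 2 1] adj_uv[of 1 1] adj_uv[of 2 1] u_neq_v[of 2 1] n m_pos by auto
  \<comment> \<open>Finiteness matters here: a sum over an infinite set is 0 by default.\<close>
  ultimately have "f (v 1) = 0"
    using finite_dist_sphere by simp
  with distance_magic_labeling_pos[OF f v_in_verts[of 1]] m_pos show False by simp
qed

text \<open>The only neighbour of an isolated bristle is \<open>u 1\<close>, so every walk of length
  2 from it ends at a neighbour of \<open>u 1\<close>.\<close>

lemma dist_sphere_2_isolated_bristle:
  assumes n: "2 \<le> n" and k: "k \<in> {1..m}"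
    and iso: "\<And>i. i \<in> {1..m} - {k} \<Longrightarrow> (v k, v i) \<notin> parcs G"
  shows "dist_sphere G 2 (v k) = insert (u 2) (v ` {1..m} - {v k})"
proof -
  have nbr: "(v k, z) \<in> parcs G \<longleftrightarrow> z = u 1" for z
  proof
    assume z: "(v k, z) \<in> parcs G"
    then have "z \<in> pverts G" using arc_snd_in_verts by fastforce
    \<comment> \<open>\<open>iso\<close> leaves out the index \<open>k\<close> itself; absence of
      loops covers it.\<close>
    moreover have "z \<noteq> v k" using z pair_no_loops by fastforce
    moreover have "i = k" if "i \<in> {1..m}" "z = v i" for i
      using that z iso[of i] by blast
    moreover have "i = 1" if "i \<in> {1..n}" "z = u i" for i
      using that z adj_vu[OF _ k] by blast
    ultimately show "z = u 1" unfolding verts_brush by blast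
  next
    show "z = u 1 \<Longrightarrow> (v k, z) \<in> parcs G" using adj_vu k n by simp
  qed
  have sphere: "y \<in> dist_sphere G 2 (v k) \<longleftrightarrow> y \<noteq> v k \<and> y \<noteq> u 1 \<and> (u 1, y) \<in> parcs G" for y
    using nbr by (auto simp: mem_dist_sphere_2_iff)
  have nbr_u1: "(u 1, y) \<in> parcs G \<longleftrightarrow> y = u 2 \<or> y \<in> v ` {1..m}" for y
  proof
    assume y: "(u 1, y) \<in> parcs G"
    then have "y \<in> pverts G" using arc_snd_in_verts by fastforce
    moreover have "i = 2" if "i \<in> {1..n}" "y = u i" for i
      using that y adj_uu[of 1 i] n by auto
    ultimately show "y = u 2 \<or> y \<in> v ` {1..m}" unfolding verts_brush by blast
  next
    show "y = u 2 \<or> y \<in> v ` {1..m} \<Longrightarrow> (u 1, y) \<in> parcs G"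
      using adj_uu[of 1 2] adj_uv[of 1] n by auto
  qed
  have "u 2 \<noteq> v k" "u 2 \<noteq> u 1" "u 1 \<notin> v ` {1..m}"
    using u_neq_v k n inj_onD[OF inj_u, of 2 1] by auto
  then show ?thesis
    unfolding set_eq_iff sphere nbr_u1 insert_iff Diff_iff by (metis empty_iff)
qed

text \<open>Both second spheres are one common set with the respective centre removed, so equal sums
  force equal labels, against injectivity.\<close>

lemma two_isolated_bristles_not_distance_magic:
  assumes n: "2 \<le> n" and kl: "k \<in> {1..m}" "l \<in> {1..m}" "k \<noteq> l"
    and iso_k: "\<And>i. i \<in> {1..m} - {k} \<Longrightarrow> (v k, v i) \<notin> parcs G"
    and iso_l: "\<And>i. i \<in> {1..m} - {l} \<Longrightarrow> (v l, v i) \<notin> parcs G"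
  shows "\<not> distance_magic G 2"
proof
  assume "distance_magic G 2"
  then obtain f where f: "distance_magic_labeling G 2 f" by (auto simp: distance_magic_def)
  let ?T = "insert (u 2) (v ` {1..m})"
  \<comment> \<open>The additive form avoids truncated subtraction on \<open>nat\<close>.\<close>
  have sphere_sum: "sum f (dist_sphere G 2 (v j)) + f (v j) = sum f ?T"
    if "j \<in> {1..m}" "\<And>i. i \<in> {1..m} - {j} \<Longrightarrow> (v j, v i) \<notin> parcs G" for j
  proof -
    \<comment> \<open>As \<open>u 2\<close> differs from \<open>v j\<close>, the deletion can be
      moved outside the \<open>insert\<close>.\<close>
    have "dist_sphere G 2 (v j) = ?T - {v j}"
      using dist_sphere_2_isolated_bristle[OF n that] u_neq_v[of 2 j] n that(1) by auto
    moreover have "sum f ?T = f (v j) + sum f (?T - {v j})"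
      by (rule sum.remove) (use that(1) in auto)
    ultimately show ?thesis by simp
  qed
  have "f (v k) = f (v l)"
    using sphere_sum[OF kl(1) iso_k] sphere_sum[OF kl(2) iso_l]
      distance_magic_labeling_sum_eq[OF f v_in_verts[OF kl(1)] v_in_verts[OF kl(2)]] by simp
  then have "v k = v l"
    using inj_onD[OF distance_magic_labeling_inj[OF f]] v_in_verts kl by blast
  with inj_onD[OF inj_v] kl show False by blast
qed

end

theorem theorem3p3:
  shows "(\<forall>(G :: 'a pair_pre_digraph) m u v.
            2 \<le> m \<longrightarrow> long_brush G 2 m u v \<longrightarrow>
            (\<forall>i\<in>{2..m}. (v 1, v i) \<notin> parcs G) \<longrightarrow>
            \<not> distance_magic G 2)
       \<and> (\<forall>(G :: 'a pair_pre_digraph) n m u v.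
            2 \<le> m \<longrightarrow> 3 \<le> n \<longrightarrow> long_brush G n m u v \<longrightarrow>
            (\<forall>i\<in>{1..m} - {1}. (v 1, v i) \<notin> parcs G) \<longrightarrow>
            (\<forall>i\<in>{1..m} - {2}. (v 2, v i) \<notin> parcs G) \<longrightarrow>
            \<not> distance_magic G 2)"
proof (intro conjI allI impI)
  fix G :: "'a pair_pre_digraph" and m u v
  assume "long_brush G 2 m u v"
  then show "\<not> distance_magic G 2"
    by (rule long_brush.short_brush_not_distance_magic) simp
next
  fix G :: "'a pair_pre_digraph" and n m u v
  assume "2 \<le> m" "3 \<le> n" and brush: "long_brush G n m u v"
    and "\<forall>i\<in>{1..m} - {1}. (v 1, v i) \<notin> parcs G"
    and "\<forall>i\<in>{1..m} - {2}. (v 2, v i) \<notin> parcs G"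
  \<comment> \<open>The bound \<open>2 \<le> m\<close> makes 1 and 2 valid bristle indices.\<close>
  then show "\<not> distance_magic G 2"
    by (intro long_brush.two_isolated_bristles_not_distance_magic[OF brush, of 1 2]) auto
qed

end
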